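(* Let $m\ge 1$ and let $A_1,\dots,A_m$ be real square matrices, $A_i\in\mathbb{R}^{n_i\times n_i}$ with $n_i\ge 1$. Let $\mathrm{Diag}(A_1,\dots,A_m)$ denote the block-diagonal matrix with diagonal blocks $A_1,\dots,A_m$. Then $$\mathcal{G}^+\left(\mathrm{Diag}(A_1,\dots,A_m)\right)=\bigcup_{\substack{z_i\in\mathcal{G}^+(A_i)\\ i=1,\dots,m}}\mathrm{Poly}(z_1,\dots,z_m),$$ where the union is over all tuples $(z_1,\dots,z_m)$ with $z_i\in\mathcal{G}^+(A_i)$ for each $i=1,\dots,m$.
   Context: Scaled relative graph. For $a,b\in\mathbb{R}^n$ let $\angle(a,b)=\arccos\left(\frac{a^Tb}{\|a\|\|b\|}\right)\in[0,\pi]$ if $a\neq0$ and $b\ne0$, and $\angle(a,b)=0$ otherwise, where $\|\cdot\|$ is the Euclidean norm. For $A\in\mathbb{R}^{n\times n}$ and nonzero $x\in\mathbb{R}^n$ define $$z_A(x)=\frac{\|Ax\|}{\|x\|}\exp[i\angle(Ax,x)]\in\mathbb{C}.$$ Let $\mathbb{C}^+=\{z\in\mathbb{C}:\mathrm{Im}\,z\ge0\}$. Then $z_A(x)\in\mathbb{C}^+$, and $\mathcal{G}^+(A)=\{z_A(x):x\in\mathbb{R}^n,\ x\ne0\}$ is the upper half of the scaled relative graph $\mathcal{G}(A)=\{z_A(x),\overline{z_A(x)}:x\in\mathbb{R}^n,\ x\neq0\}$. Arcs. For $z_1,z_2\in\mathbb{C}^+$ define $\mathrm{Arc}_{\min}(z_1,z_2)\subseteq\mathbb{C}^+$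 as follows. If $\mathrm{Re}\,z_1\ne\mathrm{Re}\,z_2$, let $\mathrm{Circ}(z_1,z_2)$ be the unique circle through $z_1$ and $z_2$ with center on the real axis; $\mathrm{Arc}_{\min}(z_1,z_2)$ is the arc of $\mathrm{Circ}(z_1,z_2)$ between $z_1$ and $z_2$ in the upper half-plane, i.e. the set of points of $\mathrm{Circ}(z_1,z_2)\cap\mathbb{C}^+$ whose real part lies between $\mathrm{Re}\,z_1$ and $\mathrm{Re}\,z_2$ (inclusive). If $\mathrm{Re}\,z_1=\mathrm{Re}\,z_2$ and $z_1\ne z_2$, then $\mathrm{Arc}_{\min}(z_1,z_2)$ is the line segment $[z_1,z_2]$. If $z_1=z_2$, then $\mathrm{Arc}_{\min}(z_1,z_2)=\{z_1\}$. Arc-edge polygon. For $m\ge1$ and $z_1,\dots,z_m\in\mathbb{C}^+$ (not necessarily distinct): if $m=1$, $\mathrm{Poly}(z_1)=\{z_1\}$; if $m\ge2$, let $S=\bigcup_{1\le i,j\le m}\mathrm{Arc}_{\min}(z_i,z_j)$ and $\mathrm{Poly}(z_1,\dots,z_m)=S\cup\{\text{region enclosed by }S\}$, where the region enclosed by $S$ is the union of all regions enclosed by Jordan curves (non-self-intersecting continuous loops) contained in $S$. *)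

theory Defs
  imports "HOL-Analysis.Analysis" "Jordan_Normal_Form.Matrix"
begin

text \<open>
  Since the block sizes vary inside the statement, matrices and vectors are those of
  Jordan_Normal_Form.  Its type of vectors carries no norm, so the
  Euclidean norm is introduced here.  Both imported libraries declare a type of vectors and an infix
  product symbol, hence the qualified type name and the prefix form of the scalar product.
\<close>

definition enorm :: "real Matrix.vec \<Rightarrow> real" where
  "enorm x = sqrt (scalar_prod x x)"

definition vangle :: "real Matrix.vec \<Rightarrow> real Matrix.vec \<Rightarrow> real" where
  "vangle a b =
     (if a \<noteq> 0\<^sub>v (dim_vec a) \<and> b \<noteq> 0\<^sub>v (dim_vec b)
      then arccos (scalar_prod a b / (enorm a * enorm b)) else 0)"

definition srg_point :: "real mat \<Rightarrow> real Matrix.vec \<Rightarrow> complex" where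
  "srg_point A x =
     complex_of_real (enorm (A *\<^sub>v x) / enorm x) *
     exp (\<i> * complex_of_real (vangle (A *\<^sub>v x) x))"

text \<open>Only meant for square matrices.\<close>

definition srg_upper :: "real mat \<Rightarrow> complex set" where
  "srg_upper A =
     {srg_point A x | x. x \<in> carrier_vec (dim_col A) \<and> x \<noteq> 0\<^sub>v (dim_col A)}"

definition circ :: "complex \<Rightarrow> complex \<Rightarrow> complex set" where
  "circ z1 z2 =
     (THE C. z1 \<in> C \<and> z2 \<in> C \<and> (\<exists>c r. r > 0 \<and> C = sphere (complex_of_real c) r))"

text \<open>The description in \<^const>\<open>circ\<close> is proper in the case in which it is used.\<close>

lemma circ_unique:
  assumes "Re z1 \<noteq> Re z2"
  shows "\<exists>!C. z1 \<in> C \<and> z2 \<in> C \<and> (\<exists>c r. r > 0 \<and> C = sphere (complex_of_real c) r)"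
proof -
  define p where "p = ((cmod z2)\<^sup>2 - (cmod z1)\<^sup>2) / (2 * (Re z2 - Re z1))"
  have key: "dist (complex_of_real c) z1 = dist (complex_of_real c) z2 \<longleftrightarrow> c = p" for c
  proof -
    have "dist (complex_of_real c) z1 = dist (complex_of_real c) z2 \<longleftrightarrow>
      (c - Re z1)\<^sup>2 + (Im z1)\<^sup>2 = (c - Re z2)\<^sup>2 + (Im z2)\<^sup>2"
      by (simp add: dist_norm cmod_def)
    also have "\<dots> \<longleftrightarrow> c * (2 * (Re z2 - Re z1)) = (cmod z2)\<^sup>2 - (cmod z1)\<^sup>2"
      unfolding cmod_power2 by (auto simp: power2_eq_square algebra_simps)
    also have "\<dots> \<longleftrightarrow> c = p"
      using assms by (simp add: p_def field_simps)
    finally show ?thesis .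
  qed
  show ?thesis
  proof (rule ex1I)
    have "z1 \<noteq> complex_of_real p"
      using key[of p] assms by auto
    then have "dist (complex_of_real p) z1 > 0"
      by simp
    moreover have "z2 \<in> sphere (complex_of_real p) (dist (complex_of_real p) z1)"
      using key[of p] by simp
    ultimately show "z1 \<in> sphere (complex_of_real p) (dist (complex_of_real p) z1) \<and>
      z2 \<in> sphere (complex_of_real p) (dist (complex_of_real p) z1) \<and>
      (\<exists>c r. r > 0 \<and> sphere (complex_of_real p) (dist (complex_of_real p) z1)
                  = sphere (complex_of_real c) r)"
      unfolding mem_sphere by blast
  next
    fix C
    assume "z1 \<in> C \<and> z2 \<in> C \<and> (\<exists>c r. r > 0 \<and> C = sphere (complex_of_real c) r)"
    then obtain c r where "z1 \<in> C" "z2 \<in> C" "C = sphere (complex_of_real c) r" by blast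
    then show "C = sphere (complex_of_real p) (dist (complex_of_real p) z1)"
      using key[of c] by auto
  qed
qed

text \<open>Only meant for points of the closed upper half-plane.\<close>

definition arc_min :: "complex \<Rightarrow> complex \<Rightarrow> complex set" where
  "arc_min z1 z2 =
     (if Re z1 \<noteq> Re z2
      then {w \<in> circ z1 z2. Im w \<ge> 0 \<and> Re w \<in> closed_segment (Re z1) (Re z2)}
      else if z1 \<noteq> z2 then closed_segment z1 z2
      else {z1})"

definition enclosed_region :: "complex set \<Rightarrow> complex set" where
  "enclosed_region S =
     \<Union> {inside (path_image g) | g.
          simple_path g \<and> pathfinish g = pathstart g \<and> path_image g \<subseteq> S}"

text \<open>The tuple is given by the values of \<open>z\<close> at \<open>1, \<dots>, m\<close>.\<close>

definition arc_poly :: "nat \<Rightarrow> (nat \<Rightarrow> complex) \<Rightarrow> complex set" where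
  "arc_poly m z =
     (if m = 1 then {z 1}
      else let S = \<Union>i\<in>{1..m}. \<Union>j\<in>{1..m}. arc_min (z i) (z j)
           in S \<union> enclosed_region S)"

end

theory Submission
  imports Defs
begin

text \<open>
  The map \<open>z \<mapsto> (Re z, \<bar>z\<bar>\<^sup>2)\<close> turns the circles centred on the real axis into straight lines.
  Hence it maps the closed upper half-plane onto the convex epigraph of a parabola, minimal arcs
  onto segments, and arc-edge polygons onto convex hulls (every point of a planar convex hull lies
  in a triangle of generators, and an open triangle is the inside of its boundary).
  On the other hand it maps the point of \<open>A\<close> given by \<open>x\<close> to
  \<open>(x \<bullet> A x, A x \<bullet> A x) / (x \<bullet> x)\<close>.  Both numerators and the denominator are additive over the
  blocks of a block-diagonal matrix, so its points are precisely the convex combinations of points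
  of the blocks.
\<close>

section \<open>Straightening the upper half-plane\<close>

text \<open>
  On the upper half-plane the second coordinate is \<open>\<bar>z\<bar>\<^sup>2\<close>.  The odd extension in \<open>Im z\<close> makes the
  map a homeomorphism of the whole plane, so that it preserves insides of Jordan curves.  Its inverse
  relies on \<^const>\<open>sqrt\<close> being odd.
\<close>

definition straighten :: "complex \<Rightarrow> complex" where
  "straighten z = Complex (Re z) ((Re z)\<^sup>2 + Im z * \<bar>Im z\<bar>)"

definition unstraighten :: "complex \<Rightarrow> complex" where
  "unstraighten p = Complex (Re p) (sqrt (Im p - (Re p)\<^sup>2))"

lemma unstraighten_straighten [simp]: "unstraighten (straighten z) = z"
proof -
  have "sqrt (y * \<bar>y\<bar>) = y" for y
    by (cases "y \<ge> 0") (simp_all add: abs_if real_sqrt_minus)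
  then show ?thesis
    by (simp add: straighten_def unstraighten_def complex_eq_iff)
qed

lemma straighten_unstraighten [simp]: "straighten (unstraighten p) = p"
proof -
  have "sqrt y * \<bar>sqrt y\<bar> = y" for y
    by (cases "y \<ge> 0") (simp_all add: abs_if)
  then show ?thesis
    by (simp add: straighten_def unstraighten_def complex_eq_iff)
qed

lemma inj_straighten: "inj straighten"
  by (metis injI unstraighten_straighten)

lemma continuous_on_straighten: "continuous_on X straighten"
  unfolding straighten_def Complex_eq by (intro continuous_intros)

lemma continuous_on_unstraighten: "continuous_on X unstraighten"
  unfolding unstraighten_def Complex_eq by (intro continuous_intros)

lemma straighten_image_iff: "w \<in> straighten ` X \<longleftrightarrow> unstraighten w \<in> X"
  by (metis image_iff straighten_unstraighten unstraighten_straighten)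

lemma straighten_eq_norm:
  assumes "Im z \<ge> 0"
  shows "straighten z = Complex (Re z) ((cmod z)\<^sup>2)"
  unfolding straighten_def cmod_power2 using assms by (simp add: power2_eq_square)

section \<open>Homeomorphisms and enclosed regions\<close>

text \<open>Pulled back by \<open>g\<close>, the component of \<open>f x\<close> in the complement
  of the image is a connected set that contains \<open>x\<close> and misses \<open>X\<close>, so it
  lies in the bounded component of \<open>x\<close>. The closure of that component is compact, hence
  its image under \<open>f\<close> is bounded.\<close>

lemma inside_image_subset:
  fixes f :: "'a::euclidean_space \<Rightarrow> 'b::euclidean_space" and g :: "'b \<Rightarrow> 'a"
  assumes f: "continuous_on UNIV f" and g: "continuous_on UNIV g"
    and gf: "\<And>x. g (f x) = x" and fg: "\<And>y. f (g y) = y"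
  shows "f ` inside X \<subseteq> inside (f ` X)"
proof
  fix y assume "y \<in> f ` inside X"
  then obtain x where y: "y = f x" and x: "x \<notin> X" "bounded (connected_component_set (- X) x)"
    by (auto simp: inside_def)
  let ?C = "connected_component_set (- (f ` X)) y"
  have "y \<notin> f ` X"
    using x(1) y gf by (metis imageE)
  then have "x \<in> g ` ?C"
    by (metis ComplI connected_component_refl gf image_eqI mem_Collect_eq y)
  moreover have "connected (g ` ?C)"
    by (rule connected_continuous_image[OF continuous_on_subset[OF g]]) auto
  moreover have "g ` ?C \<subseteq> - X"
  proof
    fix w assume "w \<in> g ` ?C"
    then obtain v where "w = g v" "v \<in> ?C" by blast
    moreover have "v \<notin> f ` X"
      using connected_component_subset[of "- (f ` X)" y] \<open>v \<in> ?C\<close> by blast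
    ultimately show "w \<in> - X"
      using fg[of v] by force
  qed
  ultimately have "g ` ?C \<subseteq> connected_component_set (- X) x"
    by (rule connected_component_maximal)
  then have "f ` g ` ?C \<subseteq> f ` closure (connected_component_set (- X) x)"
    using closure_subset by blast
  moreover have "f ` g ` ?C = ?C"
    by (simp add: image_image fg)
  moreover have "compact (f ` closure (connected_component_set (- X) x))"
    using x(2) by (intro compact_continuous_image continuous_on_subset[OF f]) auto
  ultimately have "bounded ?C"
    using bounded_subset compact_imp_bounded by metis
  with \<open>y \<notin> f ` X\<close> show "y \<in> inside (f ` X)"
    by (auto simp: inside_def)
qed

lemma inside_homeo_image:
  fixes f :: "'a::euclidean_space \<Rightarrow> 'b::euclidean_space" and g :: "'b \<Rightarrow> 'a"
  assumes f: "continuous_on UNIV f" and g: "continuous_on UNIV g"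
    and gf: "\<And>x. g (f x) = x" and fg: "\<And>y. f (g y) = y"
  shows "inside (f ` X) = f ` inside X"
proof
  show "f ` inside X \<subseteq> inside (f ` X)"
    by (rule inside_image_subset[OF assms])
  have "g ` inside (f ` X) \<subseteq> inside (g ` f ` X)"
    by (rule inside_image_subset[OF g f fg gf])
  then have "f ` g ` inside (f ` X) \<subseteq> f ` inside (g ` f ` X)"
    by (rule image_mono)
  then show "inside (f ` X) \<subseteq> f ` inside X"
    by (simp add: image_image fg gf)
qed

text \<open>A continuous injective map sends Jordan curves to Jordan curves, and a homeomorphism of
  the whole plane also carries their insides along.\<close>

lemma enclosed_region_homeo_image:
  assumes f: "continuous_on UNIV f" and g: "continuous_on UNIV g"
    and gf: "\<And>x. g (f x) = x" and fg: "\<And>y. f (g y) = y"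
  shows "enclosed_region (f ` X) = f ` enclosed_region X"
proof -
  \<comment> \<open>Stated for an arbitrary pair of mutually inverse maps, so that it can be applied
    again with the two exchanged; this yields the reverse inclusion.\<close>
  have *: "f ` enclosed_region X \<subseteq> enclosed_region (f ` X)"
    if f: "continuous_on UNIV f" and g: "continuous_on UNIV g"
      and gf: "\<And>x. g (f x) = x" and fg: "\<And>y. f (g y) = y"
    for f g :: "complex \<Rightarrow> complex" and X
  proof
    fix w assume "w \<in> f ` enclosed_region X"
    then obtain h where h: "simple_path h" "pathfinish h = pathstart h" "path_image h \<subseteq> X"
      and w: "w \<in> f ` inside (path_image h)"
      by (auto simp: enclosed_region_def)
    have "inj f"
      by (metis gf injI)
    then have "simple_path (f \<circ> h)"
      by (intro simple_path_continuous_image h continuous_on_subset[OF f])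
        (auto intro: inj_on_subset)
    moreover have "pathfinish (f \<circ> h) = pathstart (f \<circ> h)"
      using h(2) by (simp add: pathfinish_compose pathstart_compose)
    moreover have "path_image (f \<circ> h) \<subseteq> f ` X"
      using h(3) by (auto simp: path_image_compose)
    moreover have "w \<in> inside (path_image (f \<circ> h))"
      using w inside_homeo_image[OF f g gf fg] by (simp add: path_image_compose)
    ultimately show "w \<in> enclosed_region (f ` X)"
      unfolding enclosed_region_def by blast
  qed
  have "f ` g ` enclosed_region (f ` X) \<subseteq> f ` enclosed_region (g ` f ` X)"
    by (intro image_mono *[OF g f fg gf])
  then have "enclosed_region (f ` X) \<subseteq> f ` enclosed_region X"
    by (simp add: image_image fg gf)
  with *[OF f g gf fg] show ?thesis
    by blast
qed

section \<open>Minimal arcs as segments\<close>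

text \<open>This set is the straightened closed upper half-plane. Its convexity, inherited from the
  square function, keeps segments between straightened points inside it.\<close>

lemma convex_epigraph_square: "convex {p. (Re p)\<^sup>2 \<le> Im p}"
proof (rule convexI)
  fix p q :: complex and u v :: real
  assume pq: "p \<in> {p. (Re p)\<^sup>2 \<le> Im p}" "q \<in> {p. (Re p)\<^sup>2 \<le> Im p}"
    and uv: "0 \<le> u" "0 \<le> v" "u + v = 1"
  have "(u * Re p + v * Re q)\<^sup>2 \<le> u * (Re p)\<^sup>2 + v * (Re q)\<^sup>2"
  proof -
    have u: "u = 1 - v"
      using uv(3) by simp
    show ?thesis
      using convex_onD[OF convex_power2, of v "Re p" "Re q"] uv unfolding u by simp
  qed
  also have "\<dots> \<le> u * Im p + v * Im q"
    using pq uv by (intro add_mono mult_left_mono) auto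
  finally show "u *\<^sub>R p + v *\<^sub>R q \<in> {p. (Re p)\<^sup>2 \<le> Im p}"
    by simp
qed

lemma straighten_in_epigraph: "(Re (straighten z))\<^sup>2 \<le> Im (straighten z) \<longleftrightarrow> Im z \<ge> 0"
  by (auto simp: straighten_def zero_le_mult_iff)

text \<open>The two-point equation of a line, multiplied out so that it matches the equation of
  \<open>circ\<close> in \<open>in_circ_iff\<close> after straightening.\<close>

lemma in_closed_segment_iff_cross:
  assumes "Re p \<noteq> Re q"
  shows "w \<in> closed_segment p q \<longleftrightarrow> Re w \<in> closed_segment (Re p) (Re q) \<and>
    (Im w - Im p) * (Re q - Re p) = (Im q - Im p) * (Re w - Re p)"
proof
  assume "w \<in> closed_segment p q"
  then obtain u where u: "0 \<le> u" "u \<le> 1" and w: "w = (1 - u) *\<^sub>R p + u *\<^sub>R q"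
    by (auto simp: closed_segment_def)
  have "(Im w - Im p) * (Re q - Re p) = (Im q - Im p) * (Re w - Re p)"
    unfolding w by (simp add: algebra_simps)
  moreover have "Re w = (1 - u) *\<^sub>R Re p + u *\<^sub>R Re q"
    unfolding w by simp
  ultimately show "Re w \<in> closed_segment (Re p) (Re q) \<and>
    (Im w - Im p) * (Re q - Re p) = (Im q - Im p) * (Re w - Re p)"
    using u unfolding closed_segment_def by blast
next
  assume R: "Re w \<in> closed_segment (Re p) (Re q) \<and>
    (Im w - Im p) * (Re q - Re p) = (Im q - Im p) * (Re w - Re p)"
  then obtain u where u: "0 \<le> u" "u \<le> 1" "Re w = (1 - u) * Re p + u * Re q"
    by (auto simp: closed_segment_def)
  have "(Im w - Im p) * (Re q - Re p) = (u * (Im q - Im p)) * (Re q - Re p)"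
    using R u(3) by (simp add: algebra_simps)
  then have "Im w - Im p = u * (Im q - Im p)"
    using assms by simp
  then have "w = (1 - u) *\<^sub>R p + u *\<^sub>R q"
    using u(3) by (simp add: complex_eq_iff algebra_simps)
  with u show "w \<in> closed_segment p q"
    by (auto simp: closed_segment_def)
qed

text \<open>A circle with real center \<open>c\<close> and radius \<open>r\<close> is given by an
  affine relation between the squared modulus and the real part, with slope \<open>2 * c\<close>.
  Eliminating \<open>c\<close> and \<open>r\<close> by means of the two given points leaves the
  two-point equation of a line in these coordinates.\<close>

lemma in_circ_iff:
  assumes "Re z1 \<noteq> Re z2"
  shows "w \<in> circ z1 z2 \<longleftrightarrow>
    ((cmod w)\<^sup>2 - (cmod z1)\<^sup>2) * (Re z2 - Re z1) = ((cmod z2)\<^sup>2 - (cmod z1)\<^sup>2) * (Re w - Re z1)"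
proof -
  from theI'[OF circ_unique[OF assms]] obtain c r where r: "r > 0"
    and C: "circ z1 z2 = sphere (complex_of_real c) r"
    and z: "z1 \<in> circ z1 z2" "z2 \<in> circ z1 z2"
    unfolding circ_def by blast
  have on: "v \<in> circ z1 z2 \<longleftrightarrow> (cmod v)\<^sup>2 = r\<^sup>2 - c\<^sup>2 + 2 * c * Re v" for v
  proof -
    have "v \<in> circ z1 z2 \<longleftrightarrow> (cmod (of_real c - v))\<^sup>2 = r\<^sup>2"
      using r by (simp add: C dist_norm)
    also have "\<dots> \<longleftrightarrow> (cmod v)\<^sup>2 = r\<^sup>2 - c\<^sup>2 + 2 * c * Re v"
      unfolding cmod_power2 by (auto simp: power2_eq_square algebra_simps)
    finally show ?thesis .
  qed
  have z1: "(cmod z1)\<^sup>2 = r\<^sup>2 - c\<^sup>2 + 2 * c * Re z1" and z2: "(cmod z2)\<^sup>2 = r\<^sup>2 - c\<^sup>2 + 2 * c * Re z2"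
    using z on by blast+
  have diff: "(cmod z2)\<^sup>2 - (cmod z1)\<^sup>2 = 2 * c * (Re z2 - Re z1)"
    unfolding z1 z2 by (simp add: algebra_simps)
  have "((cmod w)\<^sup>2 - (cmod z1)\<^sup>2) * (Re z2 - Re z1) =
      ((cmod z2)\<^sup>2 - (cmod z1)\<^sup>2) * (Re w - Re z1) \<longleftrightarrow>
    ((cmod w)\<^sup>2 - (cmod z1)\<^sup>2) * (Re z2 - Re z1) = (2 * c * (Re w - Re z1)) * (Re z2 - Re z1)"
    unfolding diff by (simp only: mult_ac)
  also have "\<dots> \<longleftrightarrow> (cmod w)\<^sup>2 - (cmod z1)\<^sup>2 = 2 * c * (Re w - Re z1)"
    using assms by simp
  also have "\<dots> \<longleftrightarrow> w \<in> circ z1 z2"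
    unfolding on z1 by (auto simp: algebra_simps)
  finally show ?thesis by simp
qed

lemma straighten_arc_min:
  assumes "Im z1 \<ge> 0" "Im z2 \<ge> 0"
  shows "straighten ` arc_min z1 z2 = closed_segment (straighten z1) (straighten z2)"
proof -
  have "w \<in> arc_min z1 z2 \<longleftrightarrow> straighten w \<in> closed_segment (straighten z1) (straighten z2)" for w
  proof -
    \<comment> \<open>Points below the real axis belong to neither side, so the comparison may be
      restricted to the upper half-plane.\<close>
    have upper: "Im w \<ge> 0" if "straighten w \<in> closed_segment (straighten z1) (straighten z2)"
    proof -
      have "closed_segment (straighten z1) (straighten z2) \<subseteq> {p. (Re p)\<^sup>2 \<le> Im p}"
        using assms by (intro closed_segment_subset convex_epigraph_square)
          (simp_all add: straighten_in_epigraph)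
      with that show ?thesis
        using straighten_in_epigraph by blast
    qed
    show ?thesis
    proof (cases "Re z1 = Re z2")
      case False
      show ?thesis
      proof (cases "Im w \<ge> 0")
        case True
        with assms False show ?thesis
          by (simp add: arc_min_def in_circ_iff in_closed_segment_iff_cross straighten_eq_norm)
            blast
      next
        case w: False
        with False upper show ?thesis
          by (auto simp: arc_min_def)
      qed
    next
      case True
      show ?thesis
      proof (cases "z1 = z2")
        case eq: True
        then show ?thesis
          using inj_straighten by (auto simp: arc_min_def inj_def)
      next
        case neq: False
        have vert: "v \<in> closed_segment a b \<longleftrightarrow> Re v = Re a \<and> Im v \<in> closed_segment (Im a) (Im b)"
          if "Re a = Re b" for v a b
        proof -
          have "(1 - u) * r + u * r = r" for u r :: real
            by (simp add: algebra_simps)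
          then show ?thesis
            using that by (auto simp: closed_segment_def complex_eq_iff)
        qed
        have mono: "(Im x)\<^sup>2 \<le> (Im y)\<^sup>2 \<longleftrightarrow> Im x \<le> Im y" if "Im x \<ge> 0" "Im y \<ge> 0" for x y
          using that by (simp add: power2_le_iff_abs_le)
        \<comment> \<open>On a vertical line in the upper half-plane, straightening squares the
          imaginary part and adds a constant. This preserves order, hence betweenness.\<close>
        have seg: "Im (straighten w) \<in> closed_segment (Im (straighten z1)) (Im (straighten z2)) \<longleftrightarrow>
          Im w \<in> closed_segment (Im z1) (Im z2)" if "Im w \<ge> 0" "Re w = Re z1"
          using that True assms mono
          by (simp add: straighten_eq_norm closed_segment_eq_real_ivl cmod_power2)
        have nonneg: "Im w \<ge> 0" if "Im w \<in> closed_segment (Im z1) (Im z2)"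
          using that assms by (auto simp: closed_segment_eq_real_ivl split: if_splits)
        have Re: "Re (straighten v) = Re v" for v
          by (simp add: straighten_def)
        have "w \<in> arc_min z1 z2 \<longleftrightarrow> Re w = Re z1 \<and> Im w \<in> closed_segment (Im z1) (Im z2)"
          using vert[OF True, of w] True neq by (simp add: arc_min_def)
        also have "\<dots> \<longleftrightarrow> straighten w \<in> closed_segment (straighten z1) (straighten z2)"
          using vert[of "straighten z1" "straighten z2" "straighten w"] True upper seg nonneg
          unfolding Re by blast
        finally show ?thesis .
      qed
    qed
  qed
  then show ?thesis
    by (auto simp: straighten_image_iff)
qed

section \<open>Edge complexes in the plane\<close>

text \<open>A degenerate triangle is covered by its sides. Otherwise the sides form a Jordan curve
  whose inside is the interior of the triangle.\<close>

lemma triangle_subset_enclosed_region: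
  fixes a b c :: complex
  assumes "closed_segment a b \<union> closed_segment b c \<union> closed_segment c a \<subseteq> S"
  shows "convex hull {a, b, c} \<subseteq> S \<union> enclosed_region S"
proof (cases "collinear {a, b, c}")
  case True
  then have "convex hull {a, b, c} \<subseteq>
      closed_segment a b \<union> closed_segment b c \<union> closed_segment c a"
  proof -
    \<comment> \<open>The interior of a triangle is the hull minus its three sides, so an empty
      interior means that the sides cover the hull.\<close>
    have "interior (convex hull {a, b, c}) = {}"
    proof -
      have "aff_dim {a, b, c} \<le> 1"
        using True collinear_aff_dim by blast
      then show ?thesis
        using aff_dim_nonempty_interior[of "convex hull {a, b, c}"]
        by (auto simp: aff_dim_convex_hull)
    qed
    then show ?thesis
      using interior_of_triangle[of a b c] by auto
  qed
  with assms show ?thesis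
    by blast
next
  case False
  then have ne: "a \<noteq> b" "b \<noteq> c" "c \<noteq> a"
    by (auto simp: insert_commute)
  \<comment> \<open>Consecutive sides meet only in their common vertex; this makes the concatenated
    path a simple loop.\<close>
  have ab: "closed_segment a b \<inter> closed_segment b c = {b}"
    and bc: "closed_segment b c \<inter> closed_segment c a = {c}"
    and ca: "closed_segment c a \<inter> closed_segment a b = {a}"
    using False by (intro Int_closed_segment; simp add: insert_commute)+
  let ?g = "(linepath a b +++ linepath b c) +++ linepath c a"
  have "arc (linepath a b +++ linepath b c)"
    using ne ab by (intro arc_join) auto
  then have "simple_path ?g"
    using ne bc ca by (intro simple_path_join_loop) (auto simp: path_image_join)
  moreover have "path_image ?g = frontier (convex hull {a, b, c})"
    by (simp add: path_image_join frontier_of_triangle)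
  moreover have "inside (frontier (convex hull {a, b, c})) = interior (convex hull {a, b, c})"
    by (intro inside_frontier_eq_interior bounded_convex_hull convex_convex_hull) auto
  moreover have "path_image ?g \<subseteq> S"
    using assms by (auto simp: path_image_join)
  ultimately have "interior (convex hull {a, b, c}) \<subseteq> enclosed_region S"
    unfolding enclosed_region_def
    by (intro Union_upper CollectI exI[of _ ?g] conjI) simp_all
  then show ?thesis
    using assms interior_of_triangle[of a b c] by auto
qed

text \<open>A curve inside a convex set cannot enclose a point outside that set, which bounds the
  left side by the hull. Conversely, by Caratheodory's theorem in the plane every point of the hull
  lies in the hull of at most three generators, whose edges all belong to \<open>S\<close>.\<close>

lemma convex_hull_eq_edges_enclosed:
  fixes P :: "complex set"
  defines "S \<equiv> \<Union>a\<in>P. \<Union>b\<in>P. closed_segment a b"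
  shows "S \<union> enclosed_region S = convex hull P"
proof
  have "S \<subseteq> convex hull P"
    unfolding S_def by (intro UN_least closed_segment_subset convex_convex_hull hull_inc)
  moreover have "inside C \<subseteq> convex hull P" if "C \<subseteq> S" for C
    using outside_subset_convex[OF convex_convex_hull, of C P] that calculation
      inside_Int_outside[of C] by blast
  then have "enclosed_region S \<subseteq> convex hull P"
    unfolding enclosed_region_def by blast
  ultimately show "S \<union> enclosed_region S \<subseteq> convex hull P"
    by blast
next
  show "convex hull P \<subseteq> S \<union> enclosed_region S"
  proof
    fix w assume "w \<in> convex hull P"
    then obtain T where T: "finite T" "T \<subseteq> P" "card T \<le> 3" "w \<in> convex hull T"
      by (subst (asm) caratheodory) auto
    then have "T \<noteq> {}"
      by auto
    \<comment> \<open>Repetitions among \<open>a\<close>, \<open>b\<close>, \<open>c\<close> are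
      allowed, so points and segments are treated as degenerate triangles.\<close>
    then have "\<exists>a b c. T = {a, b, c}"
    proof -
      have "card T = 1 \<or> card T = 2 \<or> card T = 3"
        using T \<open>T \<noteq> {}\<close> card_gt_0_iff[of T] by linarith
      then show ?thesis
        by (auto simp: card_1_singleton_iff card_2_iff card_3_iff)
    qed
    then obtain a b c where abc: "T = {a, b, c}" by blast
    have "a \<in> P" "b \<in> P" "c \<in> P"
      using T(2) abc by auto
    then have "closed_segment a b \<union> closed_segment b c \<union> closed_segment c a \<subseteq> S"
      unfolding S_def by (intro Un_least) (intro subsetI UN_I; assumption)+
    then show "w \<in> S \<union> enclosed_region S"
      using triangle_subset_enclosed_region T(4) abc by blast
  qed
qed

section \<open>Arc-edge polygons as convex hulls\<close>

text \<open>For \<open>m = 1\<close> both sides are one singleton. Otherwise the arcs become all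
  segments between the image points, and straightening commutes with
  \<open>enclosed_region\<close>.\<close>

lemma straighten_arc_poly:
  assumes "m \<ge> 1" "\<And>i. i \<in> {1..m} \<Longrightarrow> Im (z i) \<ge> 0"
  shows "straighten ` arc_poly m z = convex hull (straighten ` z ` {1..m})"
proof (cases "m = 1")
  case True
  then show ?thesis
    by (simp add: arc_poly_def)
next
  case False
  let ?S = "\<Union>i\<in>{1..m}. \<Union>j\<in>{1..m}. arc_min (z i) (z j)"
  let ?P = "straighten ` z ` {1..m}"
  have S: "straighten ` ?S = (\<Union>a\<in>?P. \<Union>b\<in>?P. closed_segment a b)"
    using assms(2) by (simp add: image_UN straighten_arc_min)
  have "straighten ` arc_poly m z = straighten ` ?S \<union> enclosed_region (straighten ` ?S)"
    using False
      enclosed_region_homeo_image[OF continuous_on_straighten continuous_on_unstraighten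
        unstraighten_straighten straighten_unstraighten, of ?S]
    by (simp add: arc_poly_def Let_def image_Un)
  then show ?thesis
    unfolding S convex_hull_eq_edges_enclosed .
qed

section \<open>Scaled relative graphs of block-diagonal matrices\<close>

lemma scalar_prod_self_nonneg: "scalar_prod x x \<ge> (0::real)"
  by (auto simp: scalar_prod_def intro!: sum_nonneg)

lemma scalar_prod_self_eq_0_iff:
  "scalar_prod x x = (0::real) \<longleftrightarrow> x = 0\<^sub>v (dim_vec x)"
  by (auto simp: scalar_prod_def sum_nonneg_eq_0_iff) (metis index_zero_vec(1))

lemma scalar_prod_Cauchy_Schwarz:
  fixes a b :: "real Matrix.vec"
  assumes "dim_vec a = dim_vec b"
  shows "\<bar>scalar_prod a b\<bar> \<le> enorm a * enorm b"
proof (rule power2_le_imp_le)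
  show "\<bar>scalar_prod a b\<bar>\<^sup>2 \<le> (enorm a * enorm b)\<^sup>2"
    using Cauchy_Schwarz_ineq_sum[of "vec_index a" "vec_index b" "{0..<dim_vec b}"] assms
    by (simp add: enorm_def power_mult_distrib scalar_prod_self_nonneg)
      (simp add: scalar_prod_def power2_eq_square)
qed (simp add: enorm_def scalar_prod_self_nonneg)

text \<open>Cauchy-Schwarz places the quotient in the domain of \<open>arccos\<close>. When a norm
  vanishes, the quotient is 0 by the convention for division by zero.\<close>

lemma abs_scalar_prod_div_enorm_le_1:
  fixes a b :: "real Matrix.vec"
  assumes "dim_vec a = dim_vec b"
  shows "\<bar>scalar_prod a b / (enorm a * enorm b)\<bar> \<le> 1"
proof -
  have "enorm a * enorm b \<ge> 0"
    by (simp add: enorm_def scalar_prod_self_nonneg)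
  then show ?thesis
    using scalar_prod_Cauchy_Schwarz[OF assms] by (auto simp: divide_le_eq_1 order_less_le)
qed

text \<open>The straightened point before division by \<open>scalar_prod x x\<close>. It is
  quadratic in \<open>x\<close>, meaningful also for the zero vector, and additive over diagonal
  blocks.\<close>

definition srg_num :: "real mat \<Rightarrow> real Matrix.vec \<Rightarrow> complex" where
  "srg_num A x = Complex (scalar_prod (A *\<^sub>v x) x) (scalar_prod (A *\<^sub>v x) (A *\<^sub>v x))"

lemma Im_srg_point_nonneg:
  assumes "A \<in> carrier_mat n n" "x \<in> carrier_vec n"
  shows "Im (srg_point A x) \<ge> 0"
proof -
  have "vangle (A *\<^sub>v x) x \<in> {0..pi}"
    using abs_scalar_prod_div_enorm_le_1[of "A *\<^sub>v x" x] assms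
    by (auto simp: vangle_def abs_le_iff simp del: abs_divide abs_mult
        intro!: arccos_lbound arccos_ubound)
  then show ?thesis
    by (auto simp: srg_point_def Im_exp enorm_def scalar_prod_self_nonneg
        intro!: mult_nonneg_nonneg divide_nonneg_nonneg sin_ge_zero)
qed

text \<open>The modulus of the point is the ratio of the norms, and its real part is that ratio
  times the cosine of the angle; the cosine undoes the \<open>arccos\<close> and leaves the scalar
  product.\<close>

lemma straighten_srg_point:
  assumes A: "A \<in> carrier_mat n n" and x: "x \<in> carrier_vec n" "x \<noteq> 0\<^sub>v n"
  shows "straighten (srg_point A x) = srg_num A x /\<^sub>R scalar_prod x x"
proof -
  let ?y = "A *\<^sub>v x"
  have y: "?y \<in> carrier_vec n"
    using A x by simp
  have x0: "enorm x > 0"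
    using x scalar_prod_self_eq_0_iff[of x] scalar_prod_self_nonneg[of x]
    by (auto simp: enorm_def)
  have sq: "(enorm v)\<^sup>2 = scalar_prod v v" for v
    by (simp add: enorm_def scalar_prod_self_nonneg)
  \<comment> \<open>If the image of \<open>x\<close> is zero, both sides vanish whatever the angle;
    otherwise the bound on the quotient lets \<open>cos\<close> cancel
    \<open>arccos\<close>.\<close>
  have cos: "enorm ?y * enorm x * cos (vangle ?y x) = scalar_prod ?y x"
  proof (cases "?y = 0\<^sub>v n")
    case True
    then show ?thesis
      using x by (simp add: enorm_def)
  next
    case False
    then have y0: "enorm ?y > 0"
      using carrier_matD(1)[OF A] scalar_prod_self_eq_0_iff[of ?y] scalar_prod_self_nonneg[of ?y]
      by (auto simp: enorm_def)
    have "\<bar>scalar_prod ?y x / (enorm ?y * enorm x)\<bar> \<le> 1"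
      using abs_scalar_prod_div_enorm_le_1[of ?y x] carrier_vecD[OF x(1)] carrier_vecD[OF y] by metis
    moreover have "vangle ?y x = arccos (scalar_prod ?y x / (enorm ?y * enorm x))"
      using False x carrier_vecD[OF y] by (simp add: vangle_def del: dim_mult_mat_vec)
    ultimately show ?thesis
      using x0 y0 by (simp add: cos_arccos_abs)
  qed
  have "Re (srg_point A x) = enorm ?y * enorm x * cos (vangle ?y x) / (enorm x)\<^sup>2"
    using x0 by (simp add: srg_point_def Re_exp power2_eq_square)
  moreover have "(cmod (srg_point A x))\<^sup>2 = (enorm ?y)\<^sup>2 / (enorm x)\<^sup>2"
    by (simp add: srg_point_def norm_mult norm_divide power_mult_distrib power_divide)
  ultimately show ?thesis
    using straighten_eq_norm[OF Im_srg_point_nonneg[OF A x(1)]]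
    by (simp add: cos sq srg_num_def complex_eq_iff divide_inverse_commute)
qed

lemma straighten_srg_upper:
  assumes "A \<in> carrier_mat n n"
  shows "straighten ` srg_upper A =
    {srg_num A x /\<^sub>R scalar_prod x x | x. x \<in> carrier_vec n \<and> x \<noteq> 0\<^sub>v n}"
proof -
  have "srg_upper A = srg_point A ` {x. x \<in> carrier_vec n \<and> x \<noteq> 0\<^sub>v n}"
    using assms by (auto simp: srg_upper_def)
  then have "straighten ` srg_upper A =
      (\<lambda>x. srg_num A x /\<^sub>R scalar_prod x x) ` {x. x \<in> carrier_vec n \<and> x \<noteq> 0\<^sub>v n}"
    using straighten_srg_point[OF assms] by (simp add: image_image)
  then show ?thesis
    by (simp add: setcompr_eq_image)
qed

section \<open>Two diagonal blocks\<close>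

lemma srg_num_smult:
  assumes "A \<in> carrier_mat n n" "x \<in> carrier_vec n"
  shows "srg_num A (c \<cdot>\<^sub>v x) = c\<^sup>2 *\<^sub>R srg_num A x"
  using assms by (simp add: srg_num_def mult_mat_vec complex_eq_iff power2_eq_square)

text \<open>Serves for the components of a split vector, one of which may be zero. Then numerator
  and weight both vanish and any point of the graph serves as \<open>p\<close>; the condition
  \<open>n \<ge> 1\<close> guarantees that there is one.\<close>

lemma srg_num_eq_scale:
  assumes A: "A \<in> carrier_mat n n" and n: "n \<ge> 1" and x: "x \<in> carrier_vec n"
  shows "\<exists>p \<in> straighten ` srg_upper A. srg_num A x = scalar_prod x x *\<^sub>R p"
proof (cases "x = 0\<^sub>v n")
  case True
  have "unit_vec n 0 \<noteq> (0\<^sub>v n :: real Matrix.vec)"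
    using n by (auto simp: vec_eq_iff intro!: exI[of _ 0])
  then have "straighten ` srg_upper A \<noteq> {}"
    unfolding straighten_srg_upper[OF A] by fastforce
  \<comment> \<open>The zero vector is 0 times itself, so quadratic scaling makes its numerator
    zero.\<close>
  moreover have "srg_num A x = 0"
  proof -
    have "0 \<cdot>\<^sub>v x = x"
      unfolding True by auto
    with srg_num_smult[OF A x, of 0] show ?thesis
      by simp
  qed
  moreover have "scalar_prod x x = 0"
    unfolding True by simp
  ultimately show ?thesis
    by auto
next
  case False
  then have "scalar_prod x x \<noteq> 0"
    using x scalar_prod_self_eq_0_iff[of x] by auto
  with False x show ?thesis
    unfolding straighten_srg_upper[OF A]
    by (intro bexI[of _ "srg_num A x /\<^sub>R scalar_prod x x"]) auto
qed

text \<open>The point given by a concatenated vector is the mean of the points given by its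
  components, weighted by their squared norms. Rescaling the components realizes every pair of
  weights.\<close>

lemma straighten_srg_upper_four_block:
  assumes A: "A \<in> carrier_mat n n" "n \<ge> 1" and B: "B \<in> carrier_mat k k" "k \<ge> 1"
  shows "straighten ` srg_upper (four_block_mat A (0\<^sub>m n k) (0\<^sub>m k n) B) =
    (\<Union>p \<in> straighten ` srg_upper A. \<Union>q \<in> straighten ` srg_upper B. closed_segment p q)"
    (is "straighten ` srg_upper ?D = ?R")
proof -
  have D: "?D \<in> carrier_mat (n + k) (n + k)"
    using A B by simp
  have num: "srg_num ?D (x @\<^sub>v y) = srg_num A x + srg_num B y"
    if "x \<in> carrier_vec n" "y \<in> carrier_vec k" for x y
    unfolding srg_num_def mult_mat_vec_split[OF A(1) B(1) that]
    using that A B by (simp add: complex_eq_iff scalar_prod_append[of _ n _ k])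
  show ?thesis
  proof (intro equalityI subsetI)
    fix w assume "w \<in> straighten ` srg_upper ?D"
    then obtain x where w: "w = srg_num ?D x /\<^sub>R scalar_prod x x"
      and x: "x \<in> carrier_vec (n + k)" "x \<noteq> 0\<^sub>v (n + k)"
      by (auto simp: straighten_srg_upper[OF D])
    define y z where "y = vec_first x n" and "z = vec_last x k"
    have yz: "y \<in> carrier_vec n" "z \<in> carrier_vec k" and x_eq: "x = y @\<^sub>v z"
      using x by (simp_all add: y_def z_def)
    \<comment> \<open>The weights of the mean; they are not both zero because \<open>x\<close> is
      nonzero.\<close>
    define a b where "a = scalar_prod y y" and "b = scalar_prod z z"
    have ab: "scalar_prod x x = a + b"
      unfolding x_eq a_def b_def using yz by (simp add: scalar_prod_append)
    have pos: "a \<ge> 0" "b \<ge> 0" "a + b \<noteq> 0"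
      using scalar_prod_self_nonneg x scalar_prod_self_eq_0_iff[of x] ab
      by (auto simp: a_def b_def)
    obtain p where p: "p \<in> straighten ` srg_upper A" "srg_num A y = a *\<^sub>R p"
      using srg_num_eq_scale[OF A yz(1)] unfolding a_def by blast
    obtain q where q: "q \<in> straighten ` srg_upper B" "srg_num B z = b *\<^sub>R q"
      using srg_num_eq_scale[OF B yz(2)] unfolding b_def by blast
    have "w = (a *\<^sub>R p + b *\<^sub>R q) /\<^sub>R (a + b)"
      unfolding w ab p(2)[symmetric] q(2)[symmetric] using num[OF yz] by (simp add: x_eq)
    then have "w = (a / (a + b)) *\<^sub>R p + (b / (a + b)) *\<^sub>R q"
      by (simp add: scaleR_add_right divide_inverse_commute)
    moreover have "a / (a + b) = 1 - b / (a + b)"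
      using pos by (simp add: field_simps)
    ultimately have "w \<in> closed_segment p q"
      using pos unfolding closed_segment_def
      by (auto intro!: exI[of _ "b / (a + b)"] simp: divide_le_eq)
    with p q show "w \<in> ?R"
      by blast
  next
    fix w assume "w \<in> ?R"
    then obtain y z u where yz: "y \<in> carrier_vec n" "y \<noteq> 0\<^sub>v n" "z \<in> carrier_vec k" "z \<noteq> 0\<^sub>v k"
      and u: "0 \<le> u" "u \<le> 1"
      and w: "w = (1 - u) *\<^sub>R (srg_num A y /\<^sub>R scalar_prod y y) +
        u *\<^sub>R (srg_num B z /\<^sub>R scalar_prod z z)"
      unfolding straighten_srg_upper[OF A(1)] straighten_srg_upper[OF B(1)]
      by (auto simp: closed_segment_def)
    have pos: "scalar_prod y y > 0" "scalar_prod z z > 0"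
      using yz scalar_prod_self_eq_0_iff[of y] scalar_prod_self_eq_0_iff[of z]
        scalar_prod_self_nonneg[of y] scalar_prod_self_nonneg[of z] by auto
    \<comment> \<open>Chosen so that the rescaled components have squared norms \<open>1 - u\<close>
      and \<open>u\<close>, which makes the concatenation a unit vector.\<close>
    define c d where "c = sqrt ((1 - u) / scalar_prod y y)" and "d = sqrt (u / scalar_prod z z)"
    have cd: "c\<^sup>2 = (1 - u) / scalar_prod y y" "d\<^sup>2 = u / scalar_prod z z"
      using pos u by (simp_all add: c_def d_def)
    define x where "x = (c \<cdot>\<^sub>v y) @\<^sub>v (d \<cdot>\<^sub>v z)"
    have x: "x \<in> carrier_vec (n + k)"
      using yz by (simp add: x_def)
    have "scalar_prod x x = c\<^sup>2 * scalar_prod y y + d\<^sup>2 * scalar_prod z z"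
      unfolding x_def using yz by (subst scalar_prod_append) (auto simp: power2_eq_square)
    then have xx: "scalar_prod x x = 1"
      using pos by (simp add: cd)
    have "srg_num ?D x = c\<^sup>2 *\<^sub>R srg_num A y + d\<^sup>2 *\<^sub>R srg_num B z"
      unfolding x_def using yz A B by (simp add: num srg_num_smult)
    then have "w = srg_num ?D x /\<^sub>R scalar_prod x x"
      by (simp add: w xx cd divide_inverse)
    moreover have "x \<noteq> 0\<^sub>v (n + k)"
      using xx by auto
    ultimately show "w \<in> straighten ` srg_upper ?D"
      using x by (auto simp: straighten_srg_upper[OF D])
  qed
qed

section \<open>Induction over the list of blocks\<close>

lemma diag_block_mat_carrier:
  assumes "\<And>A. A \<in> set As \<Longrightarrow> square_mat A"
  shows "diag_block_mat As \<in> carrier_mat (sum_list (map dim_row As)) (sum_list (map dim_row As))"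
proof -
  have "map dim_col As = map dim_row As"
    using assms by simp
  then show ?thesis
    by (metis carrier_matI dim_diag_block_mat)
qed

text \<open>By induction on the list: splitting off the first block joins a point \<open>p\<close>
  of its graph by segments to the hull of points chosen from the remaining blocks, which is the hull
  with \<open>p\<close> inserted.\<close>

lemma straighten_srg_upper_diag_block_mat:
  assumes "As \<noteq> []" "\<And>A. A \<in> set As \<Longrightarrow> square_mat A \<and> dim_row A \<ge> 1"
  shows "straighten ` srg_upper (diag_block_mat As) =
    (\<Union>ps \<in> {ps. list_all2 (\<lambda>p A. p \<in> straighten ` srg_upper A) ps As}. convex hull (set ps))"
  using assms
proof (induction As rule: list_nonempty_induct)
  case (single A)
  have "{ps. list_all2 (\<lambda>p A. p \<in> straighten ` srg_upper A) ps [A]} =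
      (\<lambda>p. [p]) ` straighten ` srg_upper A"
    by (auto simp: list_all2_Cons2)
  then show ?case
    by (simp add: diag_block_mat_singleton del: diag_block_mat.simps)
next
  case (cons A As)
  let ?G = "\<lambda>A. straighten ` srg_upper A"
  let ?B = "diag_block_mat As"
  define n k where "n = dim_row A" and "k = sum_list (map dim_row As)"
  have A: "A \<in> carrier_mat n n" "n \<ge> 1"
    using cons.prems[of A] by (auto simp: n_def)
  have B: "?B \<in> carrier_mat k k"
    unfolding k_def using cons.prems by (intro diag_block_mat_carrier) auto
  have "k \<ge> 1"
    using cons.hyps cons.prems unfolding k_def by (cases As) fastforce+
  have IH: "?G ?B = (\<Union>ps \<in> {ps. list_all2 (\<lambda>p A. p \<in> ?G A) ps As}. convex hull (set ps))"
    using cons.prems by (intro cons.IH) auto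
  \<comment> \<open>The hull of an inserted point is a union of segments only over a nonempty set;
    \<open>ps\<close> is nonempty because it has the length of \<open>As\<close>.\<close>
  have hull: "convex hull (insert p (set ps)) = (\<Union>q \<in> convex hull (set ps). closed_segment p q)"
    if "list_all2 (\<lambda>p A. p \<in> ?G A) ps As" for p ps
    using that cons.hyps by (subst convex_hull_insert_segments) auto
  have "diag_block_mat (A # As) = four_block_mat A (0\<^sub>m n k) (0\<^sub>m k n) ?B"
    using A B by (auto simp: Let_def)
  then have "?G (diag_block_mat (A # As)) =
      (\<Union>p \<in> ?G A. \<Union>ps \<in> {ps. list_all2 (\<lambda>p A. p \<in> ?G A) ps As}.
        \<Union>q \<in> convex hull (set ps). closed_segment p q)"
    using straighten_srg_upper_four_block[OF A B \<open>k \<ge> 1\<close>] by (simp add: IH)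
  also have "\<dots> = (\<Union>p \<in> ?G A. \<Union>ps \<in> {ps. list_all2 (\<lambda>p A. p \<in> ?G A) ps As}.
        convex hull (set (p # ps)))"
    by (simp add: hull)
  also have "\<dots> = (\<Union>ps \<in> {ps. list_all2 (\<lambda>p A. p \<in> ?G A) ps (A # As)}. convex hull (set ps))"
    by (fastforce simp: list_all2_Cons2)
  finally show ?case .
qed

theorem theorem3p1:
  fixes m :: nat and n :: "nat \<Rightarrow> nat" and A :: "nat \<Rightarrow> real mat"
  assumes "m \<ge> 1"
    and "\<And>i. i \<in> {1..m} \<Longrightarrow> n i \<ge> 1"
    and "\<And>i. i \<in> {1..m} \<Longrightarrow> A i \<in> carrier_mat (n i) (n i)"
  shows "srg_upper (diag_block_mat (map A [1..<Suc m])) =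
    (\<Union>z \<in> (\<Pi>\<^sub>E i\<in>{1..m}. srg_upper (A i)). arc_poly m z)"
    (is "srg_upper ?D = (\<Union>z \<in> ?Z. arc_poly m z)")
proof -
  let ?As = "map A [1..<Suc m]"
  let ?G = "\<lambda>A. straighten ` srg_upper A"
  have dims: "square_mat B \<and> dim_row B \<ge> 1" if "B \<in> set ?As" for B
    using assms that by fastforce+
  have D: "?G ?D = (\<Union>ps \<in> {ps. list_all2 (\<lambda>p A. p \<in> ?G A) ps ?As}. convex hull (set ps))"
    using assms(1) dims by (intro straighten_srg_upper_diag_block_mat) auto
  \<comment> \<open>A convex hull depends only on the set of chosen points, so lists of straightened
    points and tuples indexed by \<open>{1..m}\<close> need to agree only in the sets that they
    yield.\<close>
  have lists: "set ` {ps. list_all2 (\<lambda>p A. p \<in> ?G A) ps ?As} = (\<lambda>z. straighten ` z ` {1..m}) ` ?Z"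
  proof (intro equalityI subsetI)
    fix X assume "X \<in> set ` {ps. list_all2 (\<lambda>p A. p \<in> ?G A) ps ?As}"
    then obtain ps where X: "X = set ps" and ps: "list_all2 (\<lambda>p A. p \<in> ?G A) ps ?As"
      by auto
    then have len: "length ps = m"
      using list_all2_lengthD by fastforce
    \<comment> \<open>Lists are indexed from 0 and tuples from 1, hence the shift; the restriction
      to \<open>{1..m}\<close> makes \<open>z\<close> a member of the extensional product.\<close>
    define z where "z = (\<lambda>i\<in>{1..m}. unstraighten (ps ! (i - 1)))"
    have "z i \<in> srg_upper (A i)" if "i \<in> {1..m}" for i
    proof -
      have "i - 1 < m"
        using that by auto
      then show ?thesis
        using list_all2_nthD2[OF ps, of "i - 1"] that
        by (simp add: z_def straighten_image_iff del: upt_Suc)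
    qed
    then have "z \<in> ?Z"
      by (auto simp: z_def)
    moreover have "straighten ` z ` {1..m} = (\<lambda>i. ps ! (i - 1)) ` {1..m}"
      by (simp add: z_def image_image)
    moreover have "(\<lambda>i. ps ! (i - 1)) ` Suc ` {0..<m} = X"
      unfolding image_image using nth_image[of m ps] by (simp add: X len)
    ultimately show "X \<in> (\<lambda>z. straighten ` z ` {1..m}) ` ?Z"
      by (metis (no_types, lifting) One_nat_def atLeastLessThanSuc_atLeastAtMost image_Suc_atLeastLessThan image_eqI)
  next
    fix X assume "X \<in> (\<lambda>z. straighten ` z ` {1..m}) ` ?Z"
    then obtain z where z: "z \<in> ?Z" and X: "X = straighten ` z ` {1..m}"
      by blast
    have "list_all2 (\<lambda>p A. p \<in> ?G A) (map (\<lambda>i. straighten (z i)) [1..<Suc m]) ?As"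
      using z by (auto simp: list_all2_map1 list_all2_map2 list_all2_same simp del: upt_Suc)
    moreover have "X = set (map (\<lambda>i. straighten (z i)) [1..<Suc m])"
      unfolding X by (simp add: image_image atLeastLessThanSuc_atLeastAtMost del: upt_Suc)
    ultimately show "X \<in> set ` {ps. list_all2 (\<lambda>p A. p \<in> ?G A) ps ?As}"
      by blast
  qed
  have poly: "straighten ` arc_poly m z = convex hull (straighten ` z ` {1..m})" if "z \<in> ?Z" for z
  proof (rule straighten_arc_poly[OF assms(1)])
    fix i assume i: "i \<in> {1..m}"
    with that have "z i \<in> srg_upper (A i)"
      by auto
    then show "Im (z i) \<ge> 0"
      using assms(3)[OF i] Im_srg_point_nonneg[OF assms(3)[OF i]] by (auto simp: srg_upper_def)
  qed
  have "?G ?D = (\<Union>X \<in> set ` {ps. list_all2 (\<lambda>p A. p \<in> ?G A) ps ?As}. convex hull X)"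
    by (simp only: D image_image)
  also have "\<dots> = straighten ` (\<Union>z \<in> ?Z. arc_poly m z)"
    unfolding lists image_UN by (simp add: poly)
  \<comment> \<open>The two sets have equal images under the injective map
    \<open>straighten\<close>, so they coincide.\<close>
  finally show ?thesis
    by (simp add: inj_image_eq_iff[OF inj_straighten])
qed

end
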